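(* Let $\mathcal{P}$ and $\mathcal{M}$ be the two eight-faced polyhedra of genus $3$ specified explicitly in the context ($\mathcal{M}$ being Mizhaev's polyhedron). Then $\mathcal{P}$ and $\mathcal{M}$ are not combinatorially equivalent, even if orientation reversal is allowed.
   Context: A polyhedron here is a closed connected polyhedral surface embedded in $\mathbb{R}^3$ whose faces are planar simple polygons. Two polyhedra are combinatorially equivalent (orientation reversal allowed) if there is a bijection between their vertex sets that carries the set of face boundary cycles of the first onto the set of face boundary cycles of the second, where cycles are regarded as unoriented (up to rotation and reversal). The polyhedron $\mathcal{P}$. Let $R_x(x,y,z)=(x,-y,-z)$, $R_y(x,y,z)=(-x,y,-z)$, $R_z(x,y,z)=(-x,-y,z)$. The $24$ vertices of $\mathcal{P}$ are given by $v_1=(-\frac{38}{7},-\frac{57}{14},-\frac52)$, $v_5=(\frac53,-\frac1{15},\frac2{15})$, $v_9=(-\frac{37}{38},-\frac54,-\frac{111}{76})$, $v_{13}=(\frac{13}{11},-\frac35,\frac{26}{55})$, $v_{17}=(\frac32,-\frac14,\frac14)$, $v_{21}=(\frac{31}{23},-\frac{62}{115},\frac35)$, and $v_{i+1}=R_zv_i$, $v_{i+2}=R_xv_i$, $v_{i+3}=R_yv_i$ for $i\in\{1,5,9,13,17,21\}$. Its eight faces are the planar polygons with the following vertex cycles (indices of the $v_i$): $A_1$ (plane $3x-4y-2z=5$): $(1,2,5,7,17,13,21,12,9)$; $A_2$ (plane $-3x+4y-2z=5$): $(6,8,18,14,22,11,10,2,1)$; $A_3$ (plane $3x+4y+2z=5$):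 $(7,5,19,15,23,10,11,3,4)$; $A_4$ (plane $-3x-4y+2z=5$): $(4,3,8,6,20,16,24,9,12)$; $B_1$ (plane $-2x+5y-5z=3$): $(1,9,24,23,15,14,18,20,6)$; $B_2$ (plane $2x-5y-5z=3$): $(13,17,19,5,2,10,23,24,16)$; $B_3$ (plane $-2x-5y+5z=3$): $(21,13,16,20,18,8,3,11,22)$; $B_4$ (plane $2x+5y+5z=3$): $(4,12,21,22,14,15,19,17,7)$. The polyhedron $\mathcal{M}$. Let $T(x,y,z)=(y,-x,-z)$, a rotoreflection of order $4$. The $24$ vertices of $\mathcal{M}$ are given by $w_1=(0,300,234)$, $w_5=(18,-126,144)$, $w_9=(-36,112,102)$, $w_{13}=(-84,48,-18)$, $w_{17}=(-72,84,18)$, $w_{21}=(9,147,207)$, and $w_{i+1}=Tw_i$, $w_{i+2}=T^2w_i$, $w_{i+3}=T^3w_i$ for $i\in\{1,5,9,13,17,21\}$. Its eight faces are the planar polygons with the following vertex cycles (indices of the $w_i$; the cycles are listed without regard to orientation): $F_1$ (plane $21x+3y-10z=-1440$): $(5,7,21,1,17,9,13,12,16)$; $F_2$ (plane $21x+3y+10z=1440$): $(7,5,23,3,19,11,15,10,14)$; $F_3$ (plane $3x+z=234$): $(1,21,18,10,15,8,22,19,3)$; $F_4$ (plane $3x-z=-234$): $(3,23,20,12,13,6,24,17,1)$; $F_5$ (plane $3y-z=234$): $(4,24,17,9,14,7,21,18,2)$; $F_6$ (plane $3y+z=-234$): $(2,22,19,11,16,5,23,20,4)$; $F_7$ (plane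 $3x-21y+10z=-1440$): $(6,8,22,2,18,10,14,9,13)$; $F_8$ (plane $3x-21y-10z=1440$): $(8,6,24,4,20,12,16,11,15)$. *)

theory Defs
  imports "HOL-Analysis.Analysis"
begin

text \<open>
  A polyhedron is given by the set of its face boundary cycles, a face being represented by a list
  of its vertices in cyclic order.  The starting point and the direction of each list
  are arbitrary; they are divided out by \<open>unoriented_cycle\<close>.
\<close>

definition unoriented_cycle :: "'a list \<Rightarrow> 'a list set" where
  "unoriented_cycle c = {rotate k c | k. True} \<union> {rotate k (rev c) | k. True}"

definition vertices :: "'a list set \<Rightarrow> 'a set" where
  "vertices F = (\<Union>c\<in>F. set c)"

definition boundary_cycles :: "'a list set \<Rightarrow> 'a list set set" where
  "boundary_cycles F = unoriented_cycle ` F"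

definition combinatorially_equivalent :: "'a list set \<Rightarrow> 'b list set \<Rightarrow> bool" where
  "combinatorially_equivalent F G \<longleftrightarrow>
     (\<exists>f. bij_betw f (vertices F) (vertices G) \<and>
          (\<lambda>C. map f ` C) ` boundary_cycles F = boundary_cycles G)"

definition Rx :: "real^3 \<Rightarrow> real^3" where "Rx p = vector [p$1, - p$2, - p$3]"
definition Ry :: "real^3 \<Rightarrow> real^3" where "Ry p = vector [- p$1, p$2, - p$3]"
definition Rz :: "real^3 \<Rightarrow> real^3" where "Rz p = vector [- p$1, - p$2, p$3]"

definition P_base :: "(real^3) list" where
  "P_base =
    [vector [-38/7, -57/14, -5/2],
     vector [5/3, -1/15, 2/15],
     vector [-37/38, -5/4, -111/76],
     vector [13/11, -3/5, 26/55],
     vector [3/2, -1/4, 1/4],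
     vector [31/23, -62/115, 3/5]]"

text \<open>
  Vertices are numbered from 1 to 24; the vertices \<open>4 * j + 1, \<dots>, 4 * j + 4\<close> form the orbit of
  the base point \<open>P_base ! j\<close>.
\<close>

definition P_vertex :: "nat \<Rightarrow> real^3" where
  "P_vertex i = ([id, Rz, Rx, Ry] ! ((i - 1) mod 4)) (P_base ! ((i - 1) div 4))"

definition P_face_indices :: "nat list list" where
  "P_face_indices =
    [[1, 2, 5, 7, 17, 13, 21, 12, 9],
     [6, 8, 18, 14, 22, 11, 10, 2, 1],
     [7, 5, 19, 15, 23, 10, 11, 3, 4],
     [4, 3, 8, 6, 20, 16, 24, 9, 12],
     [1, 9, 24, 23, 15, 14, 18, 20, 6],
     [13, 17, 19, 5, 2, 10, 23, 24, 16],
     [21, 13, 16, 20, 18, 8, 3, 11, 22],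
     [4, 12, 21, 22, 14, 15, 19, 17, 7]]"

definition polyhedron_P :: "(real^3) list set" where
  "polyhedron_P = map P_vertex ` set P_face_indices"

definition rotoreflection :: "real^3 \<Rightarrow> real^3" where "rotoreflection p = vector [p$2, - p$1, - p$3]"

definition M_base :: "(real^3) list" where
  "M_base =
    [vector [0, 300, 234],
     vector [18, -126, 144],
     vector [-36, 112, 102],
     vector [-84, 48, -18],
     vector [-72, 84, 18],
     vector [9, 147, 207]]"

definition M_vertex :: "nat \<Rightarrow> real^3" where
  "M_vertex i = (rotoreflection ^^ ((i - 1) mod 4)) (M_base ! ((i - 1) div 4))"

definition M_face_indices :: "nat list list" where
  "M_face_indices =
    [[5, 7, 21, 1, 17, 9, 13, 12, 16],
     [7, 5, 23, 3, 19, 11, 15, 10, 14],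
     [1, 21, 18, 10, 15, 8, 22, 19, 3],
     [3, 23, 20, 12, 13, 6, 24, 17, 1],
     [4, 24, 17, 9, 14, 7, 21, 18, 2],
     [2, 22, 19, 11, 16, 5, 23, 20, 4],
     [6, 8, 22, 2, 18, 10, 14, 9, 13],
     [8, 6, 24, 4, 20, 12, 16, 11, 15]]"

text \<open>Mizhaev's polyhedron.\<close>

definition polyhedron_M :: "(real^3) list set" where
  "polyhedron_M = map M_vertex ` set M_face_indices"

lemma P_vertex_eqs:
  "P_vertex (Suc 0) = vector [-38/7, -57/14, -5/2]"
  "P_vertex 2 = vector [38/7, 57/14, -5/2]"
  "P_vertex 3 = vector [-38/7, 57/14, 5/2]"
  "P_vertex 4 = vector [38/7, -57/14, 5/2]"
  "P_vertex 5 = vector [5/3, -1/15, 2/15]"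
  "P_vertex 6 = vector [-5/3, 1/15, 2/15]"
  "P_vertex 7 = vector [5/3, 1/15, -2/15]"
  "P_vertex 8 = vector [-5/3, -1/15, -2/15]"
  "P_vertex 9 = vector [-37/38, -5/4, -111/76]"
  "P_vertex 10 = vector [37/38, 5/4, -111/76]"
  "P_vertex 11 = vector [-37/38, 5/4, 111/76]"
  "P_vertex 12 = vector [37/38, -5/4, 111/76]"
  "P_vertex 13 = vector [13/11, -3/5, 26/55]"
  "P_vertex 14 = vector [-13/11, 3/5, 26/55]"
  "P_vertex 15 = vector [13/11, 3/5, -26/55]"
  "P_vertex 16 = vector [-13/11, -3/5, -26/55]"
  "P_vertex 17 = vector [3/2, -1/4, 1/4]"
  "P_vertex 18 = vector [-3/2, 1/4, 1/4]"
  "P_vertex 19 = vector [3/2, 1/4, -1/4]"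
  "P_vertex 20 = vector [-3/2, -1/4, -1/4]"
  "P_vertex 21 = vector [31/23, -62/115, 3/5]"
  "P_vertex 22 = vector [-31/23, 62/115, 3/5]"
  "P_vertex 23 = vector [31/23, 62/115, -3/5]"
  "P_vertex 24 = vector [-31/23, -62/115, -3/5]"
  by (simp_all add: P_vertex_def P_base_def Rx_def Ry_def Rz_def)

lemma rotoreflection_powers:
  "rotoreflection ^^ 2 = (\<lambda>p. rotoreflection (rotoreflection p))"
  "rotoreflection ^^ 3 = (\<lambda>p. rotoreflection (rotoreflection (rotoreflection p)))"
  by (simp_all add: fun_eq_iff numeral_2_eq_2 numeral_3_eq_3)

lemma M_vertex_eqs:
  "M_vertex (Suc 0) = vector [0, 300, 234]"
  "M_vertex 2 = vector [300, 0, -234]"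
  "M_vertex 3 = vector [0, -300, 234]"
  "M_vertex 4 = vector [-300, 0, -234]"
  "M_vertex 5 = vector [18, -126, 144]"
  "M_vertex 6 = vector [-126, -18, -144]"
  "M_vertex 7 = vector [-18, 126, 144]"
  "M_vertex 8 = vector [126, 18, -144]"
  "M_vertex 9 = vector [-36, 112, 102]"
  "M_vertex 10 = vector [112, 36, -102]"
  "M_vertex 11 = vector [36, -112, 102]"
  "M_vertex 12 = vector [-112, -36, -102]"
  "M_vertex 13 = vector [-84, 48, -18]"
  "M_vertex 14 = vector [48, 84, 18]"
  "M_vertex 15 = vector [84, -48, -18]"
  "M_vertex 16 = vector [-48, -84, 18]"
  "M_vertex 17 = vector [-72, 84, 18]"
  "M_vertex 18 = vector [84, 72, -18]"
  "M_vertex 19 = vector [72, -84, 18]"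
  "M_vertex 20 = vector [-84, -72, -18]"
  "M_vertex 21 = vector [9, 147, 207]"
  "M_vertex 22 = vector [147, -9, -207]"
  "M_vertex 23 = vector [-9, -147, 207]"
  "M_vertex 24 = vector [-147, 9, -207]"
  by (simp_all add: M_vertex_def M_base_def rotoreflection_powers rotoreflection_def)

lemma vector3_eq_iff:
  "(vector [a, b, c] :: real^3) = vector [a', b', c'] \<longleftrightarrow> a = a' \<and> b = b' \<and> c = c'"
  by (simp add: vec_eq_iff forall_3)

lemma index_list: "[1..<25] = [Suc 0, 2, 3, 4, 5, 6, 7, 8, 9, 10, 11, 12, 13, 14, 15, 16, 17, 18, 19, 20,
    21, 22, 23, 24]"
  by (simp add: upt_conv_Cons)

lemma distinct_P_vertices: "distinct (map P_vertex [1..<25])"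
  unfolding index_list by (simp add: P_vertex_eqs vector3_eq_iff)

lemma distinct_M_vertices: "distinct (map M_vertex [1..<25])"
  unfolding index_list by (simp add: M_vertex_eqs vector3_eq_iff)

definition on_plane :: "real list \<Rightarrow> real^3 \<Rightarrow> bool" where
  "on_plane e p \<longleftrightarrow> e!0 * p$1 + e!1 * p$2 + e!2 * p$3 = e!3"

lemma P_faces_planar:
  "list_all2 (\<lambda>e c. list_all (\<lambda>i. on_plane e (P_vertex i)) c)
    [[3, -4, -2, 5], [-3, 4, -2, 5], [3, 4, 2, 5], [-3, -4, 2, 5],
     [-2, 5, -5, 3], [2, -5, -5, 3], [-2, -5, 5, 3], [2, 5, 5, 3]]
    P_face_indices"
  by (simp add: P_face_indices_def on_plane_def P_vertex_eqs)

lemma M_faces_planar: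
  "list_all2 (\<lambda>e c. list_all (\<lambda>i. on_plane e (M_vertex i)) c)
    [[21, 3, -10, -1440], [21, 3, 10, 1440], [3, 0, 1, 234], [3, 0, -1, -234],
     [0, 3, -1, 234], [0, 3, 1, -234], [3, -21, 10, -1440], [3, -21, -10, 1440]]
    M_face_indices"
  by (simp add: M_face_indices_def on_plane_def M_vertex_eqs)

end

theory Submission
  imports Defs
begin

text \<open>
  Join two faces when they share exactly four vertices.  This graph on the faces is
  a combinatorial invariant.  For \<open>\<P>\<close> it consists of two 4-cycles, one of them
  \<open>A\<^sub>1 B\<^sub>2 A\<^sub>3 B\<^sub>4\<close>, whereas for \<open>\<M>\<close> it is the single 8-cycle
  \<open>F\<^sub>1 F\<^sub>4 F\<^sub>8 F\<^sub>6 F\<^sub>2 F\<^sub>3 F\<^sub>7 F\<^sub>5\<close>, which contains no 4-cycle.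
\<close>

definition has_four_cycle :: "'a set set \<Rightarrow> bool" where
  "has_four_cycle S \<longleftrightarrow> (\<exists>A\<in>S. \<exists>B\<in>S. card (A \<inter> B) = 4 \<and>
     (\<exists>C\<in>S. A \<noteq> C \<and> card (B \<inter> C) = 4 \<and>
     (\<exists>D\<in>S. B \<noteq> D \<and> card (C \<inter> D) = 4 \<and> card (D \<inter> A) = 4)))"

text \<open>An injection on the union preserves both the sizes of intersections and the distinctness
  of members. It serves twice: for the vertex bijection and for the vertex numbering.\<close>

lemma has_four_cycle_image_iff:
  assumes "inj_on f (\<Union>S)"
  shows "has_four_cycle ((`) f ` S) \<longleftrightarrow> has_four_cycle S"
proof -
  have card: "card (f ` A \<inter> f ` B) = card (A \<inter> B)" if "A \<in> S" "B \<in> S" for A B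
  proof -
    have "f ` A \<inter> f ` B = f ` (A \<inter> B)"
      using inj_on_image_Int[OF assms] that by (metis Union_upper)
    moreover have "inj_on f (A \<inter> B)"
      using inj_on_subset[OF assms] that by blast
    ultimately show ?thesis by (simp add: card_image)
  qed
  have eq: "f ` A = f ` B \<longleftrightarrow> A = B" if "A \<in> S" "B \<in> S" for A B
    using inj_on_image_eq_iff[OF assms] that by (metis Union_upper)
  show ?thesis
    \<comment> \<open>\<open>bex_simps\<close> turns quantifiers over the image into quantifiers
      over \<open>S\<close>; \<open>bex_cong\<close> supplies the memberships that
      \<open>card\<close> and \<open>eq\<close> require.\<close>
    unfolding has_four_cycle_def bex_simps by (simp add: card eq cong: bex_cong)
qed

lemma Union_set_unoriented_cycle: "\<Union>(set ` unoriented_cycle c) = set c"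
  unfolding unoriented_cycle_def by auto

text \<open>Rotation and reversal only reorder a list, so orientation disappears once a cycle is
  reduced to its vertex set.\<close>

lemma Union_set_boundary_cycles: "(\<lambda>C. \<Union>(set ` C)) ` boundary_cycles F = set ` F"
  by (simp add: boundary_cycles_def image_image Union_set_unoriented_cycle)

lemma combinatorially_equivalent_imp_has_four_cycle_iff:
  assumes "combinatorially_equivalent F G"
  shows "has_four_cycle (set ` F) \<longleftrightarrow> has_four_cycle (set ` G)"
proof -
  obtain f where f: "bij_betw f (vertices F) (vertices G)"
    and cycles: "(\<lambda>C. map f ` C) ` boundary_cycles F = boundary_cycles G"
    using assms unfolding combinatorially_equivalent_def by blast
  have "set ` G = (\<lambda>C. \<Union>(set ` C)) ` (\<lambda>C. map f ` C) ` boundary_cycles F"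
    by (simp only: cycles Union_set_boundary_cycles)
  also have "\<dots> = (`) f ` (\<lambda>C. \<Union>(set ` C)) ` boundary_cycles F"
    by (simp add: image_image image_Union)
  finally have "set ` G = (`) f ` set ` F"
    by (simp only: Union_set_boundary_cycles)
  moreover have "inj_on f (\<Union>(set ` F))"
    using f by (simp add: bij_betw_def vertices_def)
  ultimately show ?thesis by (simp add: has_four_cycle_image_iff)
qed

text \<open>Replaces points of real space by their indices, where the property can be decided by
  evaluation.\<close>

lemma has_four_cycle_relabel_iff:
  assumes "distinct (map v [1..<25])"
    and "list_all (list_all (\<lambda>i. i \<in> {1..<25})) L"
  shows "has_four_cycle (set ` map v ` set L) \<longleftrightarrow> has_four_cycle (set (map set L))"
proof -
  have "inj_on v {1..<25}"
    using assms(1) by (simp add: distinct_map)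
  then have "inj_on v (\<Union>(set (map set L)))"
    by (rule inj_on_subset) (use assms(2) in \<open>force simp: list_all_iff\<close>)
  from has_four_cycle_image_iff[OF this] show ?thesis
    by (simp add: image_image)
qed

lemma has_four_cycle_P_indices: "has_four_cycle (set (map set P_face_indices))"
  unfolding has_four_cycle_def by code_simp

text \<open>A finite search over eight faces. Each face has nine vertices, so faces sharing exactly
  four are distinct; the inequalities in \<open>has_four_cycle\<close> rule out backtracking
  walks.\<close>

lemma not_has_four_cycle_M_indices: "\<not> has_four_cycle (set (map set M_face_indices))"
  unfolding has_four_cycle_def by code_simp

lemma P_face_indices_in_range: "list_all (list_all (\<lambda>i. i \<in> {1..<25})) P_face_indices"
  by (simp add: P_face_indices_def)

lemma M_face_indices_in_range: "list_all (list_all (\<lambda>i. i \<in> {1..<25})) M_face_indices"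
  by (simp add: M_face_indices_def)

theorem proposition2:
  shows "\<not> combinatorially_equivalent polyhedron_P polyhedron_M"
proof
  assume "combinatorially_equivalent polyhedron_P polyhedron_M"
  then have "has_four_cycle (set ` polyhedron_P) \<longleftrightarrow> has_four_cycle (set ` polyhedron_M)"
    by (rule combinatorially_equivalent_imp_has_four_cycle_iff)
  moreover have "has_four_cycle (set ` polyhedron_P)"
    unfolding polyhedron_P_def
    using has_four_cycle_relabel_iff[OF distinct_P_vertices P_face_indices_in_range]
      has_four_cycle_P_indices by simp
  moreover have "\<not> has_four_cycle (set ` polyhedron_M)"
    unfolding polyhedron_M_def
    using has_four_cycle_relabel_iff[OF distinct_M_vertices M_face_indices_in_range]
      not_has_four_cycle_M_indices by simp
  ultimately show False by blast
qed

end
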